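(* The maximal ideal space $\mathfrak{M}(A_{0}+AP_{+})$ is contractible.
   Context: $\mathbb{C}_{\geq 0}=\{s\in\mathbb{C}:\operatorname{Re}(s)\geq 0\}$ and $\mathbb{C}_{>0}=\{s\in\mathbb{C}:\operatorname{Re}(s)>0\}$. $A_{0}$ is the set of functions $f:\mathbb{C}_{\geq 0}\to\mathbb{C}$ that are holomorphic in $\mathbb{C}_{>0}$, continuous on $\mathbb{C}_{\geq 0}$, and satisfy $\lim_{s\to\infty}f(s)=0$ (limit as $|s|\to\infty$ in $\mathbb{C}_{\geq 0}$). $AP_{+}$ (causal almost periodic functions) is the closure, in the supremum norm on $\mathbb{C}_{\geq 0}$, of the complex linear span of the functions $s\mapsto e^{-st}$, $t\geq 0$. $A_{0}+AP_{+}=\{f:\mathbb{C}_{\geq 0}\to\mathbb{C}: f=f_{A_0}+f_{AP_+},\ f_{A_0}\in A_0,\ f_{AP_+}\in AP_+\}$ is a Banach algebra with pointwise operations and the supremum norm $\|f\|_\infty=\sup_{s\in\mathbb{C}_{\geq 0}}|f(s)|$. $\mathfrak{M}(A_{0}+AP_{+})$ is its maximal ideal space: the set of nonzero complex algebra homomorphisms $\varphi:A_0+AP_+\to\mathbb{C}$, equipped with the weak-$*$ (Gelfand) topology. A topological space $X$ is contractible if there exist a continuous map $H:X\times[0,1]\to X$ and $x_0\in X$ such that $H(x,0)=x$ and $H(x,1)=x_0$ for all $x\in X$. *)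

theory Defs
  imports "HOL-Complex_Analysis.Complex_Analysis"
begin

definition rhp :: "complex set"
  where "rhp = {s. Re s \<ge> 0}"

definition rhp_open :: "complex set"
  where "rhp_open = {s. Re s > 0}"

text \<open>
  A function on the closed right half-plane is an element of \<open>rhp \<rightarrow>\<^sub>E UNIV\<close>, that is, it has the
  default value outside \<open>rhp\<close>. Pointwise operations are therefore restricted to \<open>rhp\<close>.
\<close>

definition A0 :: "(complex \<Rightarrow> complex) set"
  where "A0 = {f \<in> rhp \<rightarrow>\<^sub>E UNIV. f holomorphic_on rhp_open \<and> continuous_on rhp f \<and>
                 (f \<longlongrightarrow> 0) (inf at_infinity (principal rhp))}"

definition sup_norm :: "(complex \<Rightarrow> complex) \<Rightarrow> real"
  where "sup_norm f = (SUP s\<in>rhp. cmod (f s))"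

definition exp_span :: "(complex \<Rightarrow> complex) set"
  where "exp_span = {\<lambda>s\<in>rhp. \<Sum>t\<in>T. c t * exp (- (s * complex_of_real t)) |
                      (T :: real set) (c :: real \<Rightarrow> complex). finite T \<and> T \<subseteq> {0..}}"

text \<open>
  Since every element of \<open>exp_span\<close> is bounded on \<open>rhp\<close>, its closure is taken among the bounded
  functions; boundedness also ensures that the real supremum in \<open>sup_norm\<close> is not a junk value.
\<close>

definition AP_plus :: "(complex \<Rightarrow> complex) set"
  where "AP_plus = {f \<in> rhp \<rightarrow>\<^sub>E UNIV. bounded (f ` rhp) \<and>
                      (\<forall>e>0. \<exists>g\<in>exp_span. sup_norm (\<lambda>s. f s - g s) < e)}"

definition A0_AP_plus :: "(complex \<Rightarrow> complex) set"
  where "A0_AP_plus = {\<lambda>s\<in>rhp. f s + g s | f g. f \<in> A0 \<and> g \<in> AP_plus}"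

text \<open>
  Nonzero complex algebra homomorphisms on an algebra \<open>A\<close> of functions on \<open>rhp\<close>. They belong to
  \<open>A \<rightarrow>\<^sub>E UNIV\<close>, so that two of them are equal exactly when they agree on \<open>A\<close>.
\<close>

definition characters :: "(complex \<Rightarrow> complex) set \<Rightarrow> ((complex \<Rightarrow> complex) \<Rightarrow> complex) set"
  where "characters A = {\<phi> \<in> A \<rightarrow>\<^sub>E UNIV.
           (\<forall>f\<in>A. \<forall>g\<in>A. \<phi> (\<lambda>s\<in>rhp. f s + g s) = \<phi> f + \<phi> g) \<and>
           (\<forall>c. \<forall>f\<in>A. \<phi> (\<lambda>s\<in>rhp. c * f s) = c * \<phi> f) \<and>
           (\<forall>f\<in>A. \<forall>g\<in>A. \<phi> (\<lambda>s\<in>rhp. f s * g s) = \<phi> f * \<phi> g) \<and>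
           (\<exists>f\<in>A. \<phi> f \<noteq> 0)}"

text \<open>
  The weak-* topology is the topology of pointwise convergence on \<open>A\<close>, hence the subspace
  topology inherited from the product of copies of the complex plane indexed by \<open>A\<close>.
\<close>

definition maximal_ideal_space ::
    "(complex \<Rightarrow> complex) set \<Rightarrow> ((complex \<Rightarrow> complex) \<Rightarrow> complex) topology"
  where "maximal_ideal_space A =
           subtopology (product_topology (\<lambda>_. euclidean) A) (characters A)"

lemma topspace_maximal_ideal_space [simp]:
  "topspace (maximal_ideal_space A) = characters A"
  by (auto simp: maximal_ideal_space_def characters_def)

end

theory Submission
  imports Defs "HOL-Real_Asymp.Real_Asymp"
begin

text \<open>
  The contraction is induced by translation to the right. For \<open>u \<ge> 0\<close> the map
  \<open>T\<^sub>u f = f (\<cdot> + u)\<close> is an algebra endomorphism of \<open>A0 + AP_plus\<close>, so \<open>\<phi> \<mapsto> \<phi> \<circ> T\<^sub>u\<close> maps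
  characters to characters. As \<open>u \<rightarrow> \<infinity>\<close>, \<open>T\<^sub>u f\<close> converges \<^emph>\<open>in norm\<close> to the constant \<open>L f\<close>, the
  limit of \<open>f\<close> as \<open>Re s \<rightarrow> \<infinity>\<close>: elements of \<open>A0\<close> tend to \<open>0\<close>, and in an exponential sum every
  term \<open>exp (- s t)\<close> with \<open>t > 0\<close> decays uniformly, leaving the coefficient of \<open>t = 0\<close>. Setting
  \<open>T\<^sub>\<infinity> f = L f\<close> gives endomorphisms indexed by \<open>[0, \<infinity>]\<close>, a copy of the unit interval, and the
  homotopy \<open>(\<phi>, u) \<mapsto> \<phi> \<circ> T\<^sub>u\<close> joins the identity to the constant map with value the character \<open>L\<close>,
  since \<open>\<phi>\<close> sends a constant to itself.

  Joint continuity of \<open>(\<phi>, u) \<mapsto> \<phi> (T\<^sub>u f)\<close> for fixed \<open>f\<close> follows from two facts. First,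
  \<open>u \<mapsto> T\<^sub>u f\<close> is norm continuous on \<open>[0, \<infinity>]\<close> (\<open>translate_continuous\<close>), which amounts to uniform
  continuity of \<open>f\<close> on the closed half-plane together with uniform convergence as \<open>Re s \<rightarrow> \<infinity>\<close>.
  Second, characters are bounded, uniformly in \<open>\<phi>\<close>. The usual argument for this inverts \<open>1 - f\<close> when
  \<open>\<bar>f\<bar> \<le> q < 1\<close>. It is applied to the two summands separately
  (\<open>character_bound_A0\<close>, \<open>character_bound_AP_plus\<close>), where the inverse is explicit, and \<open>f\<close> is then
  handled by writing \<open>f = a + b\<close>, since \<open>\<phi> (T\<^sub>u f) = \<phi> (T\<^sub>u a) + \<phi> (T\<^sub>u b)\<close>. For \<open>a \<in> A0\<close> the inverse is \<open>1 + a / (1 - a)\<close>, whose second term again lies in \<open>A0\<close>; for \<open>b \<in> AP_plus\<close> it is the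
  Neumann series, which converges in \<open>AP_plus\<close> because that space is a uniform closure.
\<close>

section \<open>Functions that settle towards the right\<close>

lemma rhp_nonempty: "rhp \<noteq> {}"
  by (auto simp: rhp_def intro: exI[of _ 0])

lemma rhp_open_subset: "rhp_open \<subseteq> rhp"
  by (auto simp: rhp_def rhp_open_def)

lemma open_rhp_open: "open rhp_open"
  by (simp add: rhp_open_def open_halfspace_Re_gt)

lemma closed_rhp: "closed rhp"
  by (simp add: rhp_def closed_halfspace_Re_ge)

lemma convex_rhp: "convex rhp"
  by (simp add: rhp_def convex_halfspace_Re_ge)

lemma of_nat_in_rhp [simp]: "of_nat n \<in> rhp"
  by (simp add: rhp_def)

lemma add_of_real_in_rhp [simp]: "s \<in> rhp \<Longrightarrow> 0 \<le> u \<Longrightarrow> s + of_real u \<in> rhp"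
  by (simp add: rhp_def)

text \<open>
  The second condition is the Cauchy form of uniform convergence as \<open>Re s \<rightarrow> \<infinity>\<close>. Because it does
  not name the limit, both conditions visibly survive uniform limits, and so pass from exponential
  sums to \<open>AP_plus\<close>.
\<close>
definition tame :: "(complex \<Rightarrow> complex) \<Rightarrow> bool"
  where "tame f \<longleftrightarrow> uniformly_continuous_on rhp f \<and>
     (\<forall>e>0. \<exists>R. \<forall>s\<in>rhp. \<forall>z\<in>rhp. R \<le> Re s \<longrightarrow> R \<le> Re z \<longrightarrow> dist (f s) (f z) < e)"

lemma tame_equicontinuous:
  assumes "tame f" "e > 0"
  shows "\<exists>d>0. \<forall>s\<in>rhp. \<forall>z\<in>rhp. dist z s < d \<longrightarrow> dist (f z) (f s) < e"
  using assms by (simp add: tame_def uniformly_continuous_on_def)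

lemma tame_settles:
  assumes "tame f" "e > 0"
  shows "\<exists>R. \<forall>s\<in>rhp. \<forall>z\<in>rhp. R \<le> Re s \<longrightarrow> R \<le> Re z \<longrightarrow> dist (f s) (f z) < e"
  using assms by (simp add: tame_def)

lemma tame_uniform_limit:
  assumes "\<And>e. e > 0 \<Longrightarrow> \<exists>g. tame g \<and> (\<forall>s\<in>rhp. dist (f s) (g s) < e)"
  shows "tame f"
proof -
  have tri: "dist (f s) (f z) < e"
    if "dist (f s) (g s) < e/3" "dist (f z) (g z) < e/3" "dist (g s) (g z) < e/3" for g s z e
    using that dist_triangle[of "f s" "f z" "g s"] dist_triangle[of "g s" "f z" "g z"]
    by (simp add: dist_commute)
  show ?thesis
    unfolding tame_def uniformly_continuous_on_def
  proof (intro conjI allI impI)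
    fix e :: real assume "e > 0"
    then have e: "e/3 > 0" by simp
    obtain g where g: "tame g" "\<forall>s\<in>rhp. dist (f s) (g s) < e/3"
      using assms[OF e] by blast
    obtain d where "d > 0" "\<forall>s\<in>rhp. \<forall>z\<in>rhp. dist z s < d \<longrightarrow> dist (g z) (g s) < e/3"
      using tame_equicontinuous[OF g(1) e] by blast
    with g(2) show "\<exists>d>0. \<forall>s\<in>rhp. \<forall>z\<in>rhp. dist z s < d \<longrightarrow> dist (f z) (f s) < e"
      by (meson tri)
    obtain R where "\<forall>s\<in>rhp. \<forall>z\<in>rhp. R \<le> Re s \<longrightarrow> R \<le> Re z \<longrightarrow> dist (g s) (g z) < e/3"
      using tame_settles[OF g(1) e] by blast
    with g(2) show "\<exists>R. \<forall>s\<in>rhp. \<forall>z\<in>rhp. R \<le> Re s \<longrightarrow> R \<le> Re z \<longrightarrow> dist (f s) (f z) < e"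
      by (meson tri)
  qed
qed

lemma tame_cong: "tame f \<Longrightarrow> (\<And>s. s \<in> rhp \<Longrightarrow> f s = g s) \<Longrightarrow> tame g"
  by (rule tame_uniform_limit) auto

lemma tame_const: "tame (\<lambda>s. c)"
  unfolding tame_def by (auto simp: uniformly_continuous_on_const)

lemma tame_add:
  assumes f: "tame f" and g: "tame g"
  shows "tame (\<lambda>s. f s + g s)"
  unfolding tame_def
proof (intro conjI allI impI)
  show "uniformly_continuous_on rhp (\<lambda>s. f s + g s)"
    using assms by (simp add: tame_def uniformly_continuous_on_add)
  fix e :: real assume "e > 0"
  then have e: "e/2 > 0" by simp
  obtain R1 where R1: "\<forall>s\<in>rhp. \<forall>z\<in>rhp. R1 \<le> Re s \<longrightarrow> R1 \<le> Re z \<longrightarrow> dist (f s) (f z) < e/2"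
    using tame_settles[OF f e] by blast
  obtain R2 where R2: "\<forall>s\<in>rhp. \<forall>z\<in>rhp. R2 \<le> Re s \<longrightarrow> R2 \<le> Re z \<longrightarrow> dist (g s) (g z) < e/2"
    using tame_settles[OF g e] by blast
  have "dist (f s + g s) (f z + g z) < e"
    if "s \<in> rhp" "z \<in> rhp" "max R1 R2 \<le> Re s" "max R1 R2 \<le> Re z" for s z
  proof -
    have "dist (f s) (f z) < e/2" "dist (g s) (g z) < e/2" using that R1 R2 by auto
    then show ?thesis using dist_triangle_add[of "f s" "g s" "f z" "g z"] by linarith
  qed
  then show "\<exists>R. \<forall>s\<in>rhp. \<forall>z\<in>rhp. R \<le> Re s \<longrightarrow> R \<le> Re z \<longrightarrow> dist (f s + g s) (f z + g z) < e"
    by blast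
qed

lemma tame_exp:
  fixes t :: real
  assumes "0 \<le> t"
  shows "tame (\<lambda>s. c * exp (- (s * of_real t)))"
proof (cases "t = 0")
  case True
  then show ?thesis by (simp add: tame_const)
next
  case False
  with assms have t: "t > 0" by simp
  show ?thesis
    unfolding tame_def
  proof (intro conjI allI impI)
    have "cmod (c * exp (- (x * of_real t)) - c * exp (- (y * of_real t))) \<le> (cmod c * t) * cmod (x - y)"
      if "x \<in> rhp" "y \<in> rhp" for x y
    proof (rule field_differentiable_bound[OF convex_rhp _ _ that])
      fix z assume z: "z \<in> rhp"
      show "((\<lambda>s. c * exp (- (s * of_real t))) has_field_derivative
             (- (c * of_real t * exp (- (z * of_real t))))) (at z within rhp)"
        by (auto intro!: derivative_eq_intros)
      show "cmod (- (c * of_real t * exp (- (z * of_real t)))) \<le> cmod c * t"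
        using z t mult_left_le[of "exp (- (Re z * t))" "cmod c * t"]
        by (simp add: norm_mult rhp_def)
    qed
    then have "(cmod c * t)-lipschitz_on rhp (\<lambda>s. c * exp (- (s * of_real t)))"
      using t by (intro lipschitz_onI) (auto simp: dist_norm)
    then show "uniformly_continuous_on rhp (\<lambda>s. c * exp (- (s * of_real t)))"
      by (rule lipschitz_on_uniformly_continuous)
  next
    fix e :: real assume e: "e > 0"
    \<comment> \<open>For positive \<open>t\<close> the values themselves become small, so any two of them are close.\<close>
    have "((\<lambda>x. cmod c * exp (- (x * t))) \<longlongrightarrow> cmod c * 0) at_top"
      using t by real_asymp
    then have "eventually (\<lambda>x. cmod c * exp (- (x * t)) < e/2) at_top"
      using e by (intro order_tendstoD(2)[where y = "cmod c * 0"]) auto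
    then obtain R where R: "\<And>x. x \<ge> R \<Longrightarrow> cmod c * exp (- (x * t)) < e/2"
      by (auto simp: eventually_at_top_linorder)
    show "\<exists>R. \<forall>s\<in>rhp. \<forall>z\<in>rhp. R \<le> Re s \<longrightarrow> R \<le> Re z \<longrightarrow>
       dist (c * exp (- (s * of_real t))) (c * exp (- (z * of_real t))) < e"
    proof (intro exI ballI impI)
      fix s z assume "R \<le> Re s" "R \<le> Re z"
      then have "cmod (c * exp (- (s * of_real t))) < e/2" "cmod (c * exp (- (z * of_real t))) < e/2"
        using R by (simp_all add: norm_mult)
      then show "dist (c * exp (- (s * of_real t))) (c * exp (- (z * of_real t))) < e"
        using norm_triangle_ineq4[of "c * exp (- (s * of_real t))" "c * exp (- (z * of_real t))"]
        unfolding dist_norm by linarith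
    qed
  qed
qed

text \<open>
  For tame functions the limit as \<open>Re s \<rightarrow> \<infinity>\<close> can be read off along the natural numbers; this turns
  its algebraic properties into limit laws for sequences.
\<close>
definition right_limit :: "(complex \<Rightarrow> complex) \<Rightarrow> complex"
  where "right_limit f = lim (\<lambda>n. f (of_nat n))"

lemma tendsto_right_limit:
  assumes "tame f"
  shows "(\<lambda>n. f (of_nat n)) \<longlonglongrightarrow> right_limit f"
proof -
  have "Cauchy (\<lambda>n. f (of_nat n))"
  proof (rule metric_CauchyI)
    fix e :: real assume "e > 0"
    then obtain R where R: "\<forall>s\<in>rhp. \<forall>z\<in>rhp. R \<le> Re s \<longrightarrow> R \<le> Re z \<longrightarrow> dist (f s) (f z) < e"
      using tame_settles[OF assms] by blast
    obtain N where "R \<le> real N" using real_arch_simple by blast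
    then show "\<exists>M. \<forall>m\<ge>M. \<forall>n\<ge>M. dist (f (of_nat m)) (f (of_nat n)) < e"
      using R by (intro exI[of _ N]) auto
  qed
  then show ?thesis
    unfolding right_limit_def
    by (simp add: Cauchy_convergent_iff convergent_LIMSEQ_iff)
qed

lemma right_limit_approx:
  assumes "tame f" "e > 0"
  obtains R where "\<And>s. s \<in> rhp \<Longrightarrow> R \<le> Re s \<Longrightarrow> dist (f s) (right_limit f) < e"
proof -
  obtain R where R: "\<forall>s\<in>rhp. \<forall>z\<in>rhp. R \<le> Re s \<longrightarrow> R \<le> Re z \<longrightarrow> dist (f s) (f z) < e/2"
    using tame_settles[OF assms(1), of "e/2"] assms(2) by auto
  have "dist (f s) (right_limit f) \<le> e/2" if s: "s \<in> rhp" "R \<le> Re s" for s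
  proof (rule LIMSEQ_le_const2)
    show "(\<lambda>n. dist (f s) (f (of_nat n))) \<longlonglongrightarrow> dist (f s) (right_limit f)"
      by (intro tendsto_intros tendsto_right_limit assms)
    obtain N where "R \<le> real N" using real_arch_simple by blast
    then have "\<forall>n\<ge>N. dist (f s) (f (of_nat n)) \<le> e/2"
      using R s by (auto intro!: less_imp_le)
    then show "\<exists>N. \<forall>n\<ge>N. dist (f s) (f (of_nat n)) \<le> e/2" by blast
  qed
  then show ?thesis using that \<open>e > 0\<close> by fastforce
qed

section \<open>The translation semigroup, compactified at infinity\<close>

text \<open>
  The translation length \<open>v / (1 - v)\<close> runs through \<open>[0, \<infinity>)\<close> as \<open>v\<close> runs through \<open>[0, 1)\<close>, so
  \<open>v = 1\<close> stands for translation by infinity.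
\<close>
definition translate :: "real \<Rightarrow> (complex \<Rightarrow> complex) \<Rightarrow> complex \<Rightarrow> complex"
  where "translate v f =
    (\<lambda>s\<in>rhp. if v < 1 then f (s + of_real (v / (1 - v))) else right_limit f)"

lemma translate_less_1:
  "v < 1 \<Longrightarrow> translate v f = (\<lambda>s\<in>rhp. f (s + of_real (v / (1 - v))))"
  unfolding translate_def by (simp only: if_True)

lemma translate_apply:
  "v < 1 \<Longrightarrow> s \<in> rhp \<Longrightarrow> translate v f s = f (s + of_real (v / (1 - v)))"
  by (simp add: translate_def)

lemma translated_in_rhp:
  "v \<in> {0..1} \<Longrightarrow> v < 1 \<Longrightarrow> s \<in> rhp \<Longrightarrow> s + of_real (v / (1 - v)) \<in> rhp"
  by (rule add_of_real_in_rhp) auto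

lemma translate_0: "f \<in> extensional rhp \<Longrightarrow> translate 0 f = f"
  by (auto simp: translate_def extensional_def)

lemma translate_1: "translate 1 f = (\<lambda>s\<in>rhp. right_limit f)"
  by (simp add: translate_def)

lemma right_limit_const: "right_limit (\<lambda>s\<in>rhp. c) = c"
  unfolding right_limit_def by (simp add: limI)

lemma translate_const: "v \<in> {0..1} \<Longrightarrow> translate v (\<lambda>s\<in>rhp. c) = (\<lambda>s\<in>rhp. c)"
  using translated_in_rhp[of v]
  by (auto simp: translate_def right_limit_const fun_eq_iff simp del: of_real_divide)

text \<open>
  Stated for an arbitrary continuous binary operation, so that compatibility of \<open>translate\<close> with sums,
  products and scalar multiples has one common proof.
\<close>
lemma right_limit_lift2:
  assumes "tame f" "tame g" "\<And>x y. isCont (\<lambda>p. F (fst p) (snd p)) (x, y)"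
  shows "right_limit (\<lambda>s\<in>rhp. F (f s) (g s)) = F (right_limit f) (right_limit g)"
proof -
  have "(\<lambda>n. F (f (of_nat n)) (g (of_nat n))) \<longlonglongrightarrow> F (right_limit f) (right_limit g)"
    using isCont_tendsto_compose[OF assms(3) tendsto_Pair[OF assms(1,2)[THEN tendsto_right_limit]]]
    by simp
  then show ?thesis
    unfolding right_limit_def[of "restrict _ _"] by (simp add: limI)
qed

lemma translate_lift2:
  assumes "tame f" "tame g" "\<And>x y. isCont (\<lambda>p. F (fst p) (snd p)) (x, y)" "v \<in> {0..1}"
  shows "translate v (\<lambda>s\<in>rhp. F (f s) (g s)) =
         (\<lambda>s\<in>rhp. F (translate v f s) (translate v g s))"
  using right_limit_lift2[OF assms(1-3)] translated_in_rhp[OF assms(4)]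
  by (auto simp: translate_def fun_eq_iff simp del: of_real_divide)

text \<open>
  Norm continuity of the translation semigroup on the compactified half-line: at finite translation
  lengths this is uniform continuity of \<open>f\<close>, at infinity it is uniform convergence to \<open>right_limit f\<close>.
\<close>
lemma translate_continuous:
  assumes f: "tame f" and v0: "v0 \<in> {0..1}" and e: "e > 0"
  obtains d where "d > 0"
    "\<And>v s. v \<in> {0..1} \<Longrightarrow> dist v v0 < d \<Longrightarrow> s \<in> rhp \<Longrightarrow>
       dist (translate v f s) (translate v0 f s) < e"
proof (cases "v0 < 1")
  case True
  obtain r where r: "r > 0" "\<forall>s\<in>rhp. \<forall>z\<in>rhp. dist z s < r \<longrightarrow> dist (f z) (f s) < e"
    using tame_equicontinuous[OF f e] by blast
  have "isCont (\<lambda>v. v / (1 - v)) v0"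
    using True by (intro continuous_intros) auto
  then obtain d where d: "d > 0" "\<And>v. dist v v0 < d \<Longrightarrow> dist (v / (1 - v)) (v0 / (1 - v0)) < r"
    using r(1) unfolding continuous_at_eps_delta by (auto simp: dist_norm)
  show ?thesis
  proof
    show "min d (1 - v0) > 0" using d True by simp
    fix v s assume v: "v \<in> {0..1}" "dist v v0 < min d (1 - v0)" and s: "s \<in> rhp"
    then have "v < 1" by (auto simp: dist_real_def)
    moreover have "dist (s + of_real (v / (1 - v))) (s + of_real (v0 / (1 - v0))) < r"
      using d(2)[of v] v(2) by (simp only: dist_add_cancel dist_of_real)
    ultimately show "dist (translate v f s) (translate v0 f s) < e"
      using r(2) translated_in_rhp[OF v(1) _ s] translated_in_rhp[OF v0 True s] s True
      by (simp add: translate_apply del: of_real_divide)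
  qed
next
  case False
  with v0 have [simp]: "v0 = 1" by simp
  obtain R where R: "\<And>s. s \<in> rhp \<Longrightarrow> R \<le> Re s \<Longrightarrow> dist (f s) (right_limit f) < e"
    using right_limit_approx[OF f e] by blast
  have "filterlim (\<lambda>v::real. v / (1 - v)) at_top (at_left 1)"
    by real_asymp
  then have "eventually (\<lambda>v. R \<le> v / (1 - v)) (at_left (1::real))"
    by (simp add: filterlim_at_top)
  then obtain b where b: "b < 1" "\<And>v. b < v \<Longrightarrow> v < 1 \<Longrightarrow> R \<le> v / (1 - v)"
    using eventually_at_left[of 0 "1::real"] by auto
  show ?thesis
  proof
    show "1 - b > 0" using b by simp
    fix v s assume v: "v \<in> {0..1}" "dist v v0 < 1 - b" and s: "s \<in> rhp"
    show "dist (translate v f s) (translate v0 f s) < e"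
    proof (cases "v < 1")
      case True
      then have "R \<le> v / (1 - v)" using v b by (auto simp: dist_real_def)
      then have "R \<le> Re (s + of_real (v / (1 - v)))" using s by (simp add: rhp_def)
      with R[OF translated_in_rhp[OF v(1) True s]] True s show ?thesis
        by (simp add: translate_apply translate_1 del: of_real_divide)
    qed (use v s e in \<open>simp add: translate_def\<close>)
  qed
qed

section \<open>Causal almost periodic functions\<close>

text \<open>
  Building sums term by term avoids manipulating the finite exponent sets, for instance when two sums
  are multiplied and different pairs of exponents may have the same total.
\<close>
lemma exp_span_induct [consumes 1, case_names zero add]:
  assumes f: "f \<in> exp_span"
    and zero: "P (\<lambda>s\<in>rhp. 0)"
    and add: "\<And>c t g. 0 \<le> t \<Longrightarrow> g \<in> exp_span \<Longrightarrow> P g \<Longrightarrow>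
                P (\<lambda>s\<in>rhp. c * exp (- (s * complex_of_real t)) + g s)"
  shows "P f"
proof -
  obtain T c where T: "finite T" "T \<subseteq> {0..}"
    and feq: "f = (\<lambda>s\<in>rhp. \<Sum>t\<in>T. c t * exp (- (s * complex_of_real t)))"
    using f by (auto simp: exp_span_def)
  have "P (\<lambda>s\<in>rhp. \<Sum>t\<in>T. c t * exp (- (s * complex_of_real t)))"
    using T
  proof (induction T rule: finite_induct)
    case (insert t T)
    define g where "g = (\<lambda>s\<in>rhp. \<Sum>t\<in>T. c t * exp (- (s * complex_of_real t)))"
    have "g \<in> exp_span" "P g"
      using insert unfolding g_def exp_span_def by blast+
    then have "P (\<lambda>s\<in>rhp. c t * exp (- (s * complex_of_real t)) + g s)"
      using insert.prems by (intro add) auto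
    also have "(\<lambda>s\<in>rhp. c t * exp (- (s * complex_of_real t)) + g s) =
        (\<lambda>s\<in>rhp. \<Sum>t\<in>insert t T. c t * exp (- (s * complex_of_real t)))"
      using insert.hyps by (auto simp: g_def fun_eq_iff)
    finally show ?case .
  qed (use zero in simp)
  then show ?thesis by (simp add: feq)
qed

lemma exp_span_extensional: "f \<in> exp_span \<Longrightarrow> f \<in> extensional rhp"
  by (auto simp: exp_span_def)

lemma exp_in_exp_span:
  assumes "0 \<le> t"
  shows "(\<lambda>s\<in>rhp. c * exp (- (s * complex_of_real t))) \<in> exp_span"
  unfolding exp_span_def using assms
  by (intro CollectI exI[of _ "{t}"] exI[of _ "\<lambda>_. c"]) auto

lemma exp_span_lincomb:
  assumes "f \<in> exp_span" "g \<in> exp_span"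
  shows "(\<lambda>s\<in>rhp. a * f s + b * g s) \<in> exp_span"
proof -
  obtain T c where T: "finite T" "T \<subseteq> {0..}"
    and f: "f = (\<lambda>s\<in>rhp. \<Sum>t\<in>T. c t * exp (- (s * complex_of_real t)))"
    using assms(1) by (auto simp: exp_span_def)
  obtain U d where U: "finite U" "U \<subseteq> {0..}"
    and g: "g = (\<lambda>s\<in>rhp. \<Sum>t\<in>U. d t * exp (- (s * complex_of_real t)))"
    using assms(2) by (auto simp: exp_span_def)
  define c' d' where "c' t = (if t \<in> T then c t else 0)" and "d' t = (if t \<in> U then d t else 0)" for t
  have 1: "(\<Sum>t\<in>T. c t * E t) = (\<Sum>t\<in>T\<union>U. c' t * E t)" for E
    using T U by (intro sum.mono_neutral_cong_left) (auto simp: c'_def)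
  have 2: "(\<Sum>t\<in>U. d t * E t) = (\<Sum>t\<in>T\<union>U. d' t * E t)" for E
    using T U by (intro sum.mono_neutral_cong_left) (auto simp: d'_def)
  have "(\<lambda>s\<in>rhp. a * f s + b * g s) =
    (\<lambda>s\<in>rhp. \<Sum>t\<in>T\<union>U. (a * c' t + b * d' t) * exp (- (s * complex_of_real t)))"
    by (auto simp: f g 1 2 fun_eq_iff sum_distrib_left ring_distribs sum.distrib mult.assoc)
  then show ?thesis
    unfolding exp_span_def using T U
    by (intro CollectI exI[of _ "T \<union> U"] exI[of _ "\<lambda>t. a * c' t + b * d' t"]) auto
qed

lemma exp_span_zero: "(\<lambda>s\<in>rhp. 0) \<in> exp_span"
  using exp_in_exp_span[of 0 0] by simp

lemma exp_span_mult:
  assumes f: "f \<in> exp_span" and g: "g \<in> exp_span"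
  shows "(\<lambda>s\<in>rhp. f s * g s) \<in> exp_span"
  using f
proof (induction rule: exp_span_induct)
  case zero
  show ?case using exp_span_zero by (simp add: restrict_def cong: if_cong)
next
  case (add c t h)
  have "(\<lambda>s\<in>rhp. (c * exp (- (s * complex_of_real t))) * g s) \<in> exp_span"
    using g
  proof (induction rule: exp_span_induct)
    case zero
    show ?case using exp_span_zero by (simp add: restrict_def cong: if_cong)
  next
    case (add d u k)
    have "(\<lambda>s\<in>rhp. (c * d) * exp (- (s * complex_of_real (t + u)))) \<in> exp_span"
      using \<open>0 \<le> t\<close> \<open>0 \<le> u\<close> by (intro exp_in_exp_span) simp
    from exp_span_lincomb[OF this add.IH, of 1 1] show ?case
      by (auto elim!: back_subst[of "\<lambda>x. x \<in> exp_span"]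
          simp: fun_eq_iff exp_add[symmetric] algebra_simps)
  qed
  from exp_span_lincomb[OF this add.IH, of 1 1] show ?case
    by (auto elim!: back_subst[of "\<lambda>x. x \<in> exp_span"] simp: fun_eq_iff algebra_simps)
qed

lemma exp_span_shift:
  assumes f: "f \<in> exp_span" and u: "0 \<le> u"
  shows "(\<lambda>s\<in>rhp. f (s + of_real u)) \<in> exp_span"
  using f
proof (induction rule: exp_span_induct)
  case zero
  show ?case using exp_span_zero u by (simp add: restrict_def cong: if_cong)
next
  case (add c t h)
  have "(\<lambda>s\<in>rhp. (c * exp (- (of_real u * of_real t))) * exp (- (s * complex_of_real t))) \<in> exp_span"
    using add by (intro exp_in_exp_span)
  from exp_span_lincomb[OF this add.IH, of 1 1] show ?case
    using u by (auto elim!: back_subst[of "\<lambda>x. x \<in> exp_span"]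
        simp: fun_eq_iff ring_distribs exp_add exp_diff exp_minus field_simps)
qed

lemma tame_exp_span: "f \<in> exp_span \<Longrightarrow> tame f"
proof (induction rule: exp_span_induct)
  case zero
  show ?case by (rule tame_cong[OF tame_const[of 0]]) simp
next
  case (add c t h)
  show ?case by (rule tame_cong[OF tame_add[OF tame_exp[OF add(1)] add.IH]]) simp
qed

lemma exp_span_holomorphic: "f \<in> exp_span \<Longrightarrow> f holomorphic_on rhp_open"
proof (induction rule: exp_span_induct)
  case zero
  show ?case
    by (rule holomorphic_transform[of "\<lambda>_. 0"]) (use rhp_open_subset in auto)
next
  case (add c t h)
  have "(\<lambda>s. c * exp (- (s * complex_of_real t)) + h s) holomorphic_on rhp_open"
    by (intro holomorphic_intros add.IH)
  then show ?case
    by (rule holomorphic_transform) (use rhp_open_subset in auto)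
qed

lemma exp_span_bounded: "f \<in> exp_span \<Longrightarrow> bounded (f ` rhp)"
proof (induction rule: exp_span_induct)
  case zero
  show ?case by (auto simp: bounded_iff)
next
  case (add c t h)
  then obtain M where M: "\<And>s. s \<in> rhp \<Longrightarrow> cmod (h s) \<le> M"
    by (auto simp: bounded_iff)
  have "cmod (c * exp (- (s * complex_of_real t)) + h s) \<le> cmod c + M" if s: "s \<in> rhp" for s
  proof -
    have "cmod (c * exp (- (s * complex_of_real t))) \<le> cmod c"
      using s add(1) by (auto simp: norm_mult rhp_def intro!: mult_left_le)
    with M[OF s] show ?thesis by (intro norm_triangle_le) linarith
  qed
  then show ?case by (auto simp: bounded_iff)
qed

text \<open>
  Pointwise estimates replace \<open>sup_norm\<close> here; boundedness is then automatic, being inherited from an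
  exponential sum within distance \<open>1\<close>.
\<close>
lemma AP_plus_iff:
  "f \<in> AP_plus \<longleftrightarrow> f \<in> extensional rhp \<and>
     (\<forall>e>0. \<exists>g\<in>exp_span. \<forall>s\<in>rhp. dist (f s) (g s) < e)"
proof (intro iffI conjI allI impI)
  assume f: "f \<in> AP_plus"
  then show "f \<in> extensional rhp" by (simp add: AP_plus_def PiE_def)
  fix e :: real assume "e > 0"
  with f obtain g where g: "g \<in> exp_span" and less: "sup_norm (\<lambda>s. f s - g s) < e"
    by (auto simp: AP_plus_def)
  have "bounded (f ` rhp)" "bounded (g ` rhp)"
    using f exp_span_bounded[OF g] by (auto simp: AP_plus_def)
  then have "bounded ((\<lambda>s. f s - g s) ` rhp)"
    by (rule bounded_minus_comp)
  then have "bdd_above ((\<lambda>s. cmod (f s - g s)) ` rhp)"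
    by (auto simp: bounded_iff bdd_above_def)
  then have "cmod (f s - g s) \<le> sup_norm (\<lambda>s. f s - g s)" if "s \<in> rhp" for s
    unfolding sup_norm_def by (rule cSUP_upper[OF that])
  with g less show "\<exists>g\<in>exp_span. \<forall>s\<in>rhp. dist (f s) (g s) < e"
    by (force simp: dist_norm)
next
  assume f: "f \<in> extensional rhp \<and> (\<forall>e>0. \<exists>g\<in>exp_span. \<forall>s\<in>rhp. dist (f s) (g s) < e)"
  then obtain g where g: "g \<in> exp_span" "\<forall>s\<in>rhp. dist (f s) (g s) < 1"
    using zero_less_one by blast
  obtain M where M: "\<And>s. s \<in> rhp \<Longrightarrow> cmod (g s) \<le> M"
    using exp_span_bounded[OF g(1)] by (auto simp: bounded_iff)
  have "cmod (f s) \<le> M + 1" if "s \<in> rhp" for s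
    using M[OF that] g(2) that norm_triangle_sub[of "f s" "g s"] by (force simp: dist_norm)
  then have "bounded (f ` rhp)" by (auto simp: bounded_iff)
  moreover have "\<exists>g\<in>exp_span. sup_norm (\<lambda>s. f s - g s) < e" if "e > 0" for e
  proof -
    from that have "e/2 > 0" by simp
    with f obtain g where g: "g \<in> exp_span" "\<forall>s\<in>rhp. dist (f s) (g s) < e/2" by blast
    have "sup_norm (\<lambda>s. f s - g s) \<le> e/2"
      unfolding sup_norm_def using g(2) rhp_nonempty
      by (intro cSUP_least) (auto simp: dist_norm intro: less_imp_le)
    with g(1) that show ?thesis by force
  qed
  ultimately show "f \<in> AP_plus" using f by (simp add: AP_plus_def PiE_def)
qed

lemma AP_plus_bounded: "f \<in> AP_plus \<Longrightarrow> bounded (f ` rhp)"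
  by (simp add: AP_plus_def)

lemma AP_plus_approx:
  assumes "f \<in> AP_plus" "e > 0"
  obtains g where "g \<in> exp_span" "\<And>s. s \<in> rhp \<Longrightarrow> dist (f s) (g s) < e"
  using assms by (auto simp: AP_plus_iff)

lemma exp_span_subset_AP_plus: "exp_span \<subseteq> AP_plus"
proof
  fix f assume "f \<in> exp_span"
  then show "f \<in> AP_plus"
    using exp_span_extensional by (auto simp: AP_plus_iff intro!: bexI[of _ f])
qed

lemma AP_plus_uniform_limit:
  assumes "f \<in> extensional rhp"
    and "\<And>e. e > 0 \<Longrightarrow> \<exists>g\<in>AP_plus. \<forall>s\<in>rhp. dist (f s) (g s) < e"
  shows "f \<in> AP_plus"
  unfolding AP_plus_iff
proof (intro conjI allI impI assms(1))
  fix e :: real assume "e > 0"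
  then have e: "e/2 > 0" by simp
  obtain g where g: "g \<in> AP_plus" "\<forall>s\<in>rhp. dist (f s) (g s) < e/2"
    using assms(2)[OF e] by blast
  obtain h where h: "h \<in> exp_span" "\<And>s. s \<in> rhp \<Longrightarrow> dist (g s) (h s) < e/2"
    using AP_plus_approx[OF g(1) e] by blast
  have "dist (f s) (h s) < e" if "s \<in> rhp" for s
    using g(2) h(2)[OF that] that dist_triangle_half_r[of "g s" "f s" e "h s"]
    by (simp add: dist_commute)
  with h(1) show "\<exists>g\<in>exp_span. \<forall>s\<in>rhp. dist (f s) (g s) < e" by blast
qed

lemma AP_plus_const: "(\<lambda>s\<in>rhp. c) \<in> AP_plus"
  using exp_in_exp_span[of 0 c] exp_span_subset_AP_plus by auto

lemma AP_plus_lincomb: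
  assumes "f \<in> AP_plus" "g \<in> AP_plus"
  shows "(\<lambda>s\<in>rhp. a * f s + b * g s) \<in> AP_plus"
proof (rule AP_plus_uniform_limit)
  fix e :: real assume "e > 0"
  \<comment> \<open>The summand \<open>1\<close> keeps \<open>m\<close> positive when both coefficients vanish.\<close>
  define m where "m = cmod a + cmod b + 1"
  have m: "m > 0" by (simp add: m_def add_nonneg_pos)
  with \<open>e > 0\<close> have e: "e / m > 0" by simp
  obtain f' where f': "f' \<in> exp_span" "\<And>s. s \<in> rhp \<Longrightarrow> dist (f s) (f' s) < e / m"
    using AP_plus_approx[OF assms(1) e] by blast
  obtain g' where g': "g' \<in> exp_span" "\<And>s. s \<in> rhp \<Longrightarrow> dist (g s) (g' s) < e / m"
    using AP_plus_approx[OF assms(2) e] by blast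
  show "\<exists>h\<in>AP_plus. \<forall>s\<in>rhp. dist ((\<lambda>s\<in>rhp. a * f s + b * g s) s) (h s) < e"
  proof (intro bexI ballI)
    show "(\<lambda>s\<in>rhp. a * f' s + b * g' s) \<in> AP_plus"
      using exp_span_lincomb[OF f'(1) g'(1)] exp_span_subset_AP_plus by blast
    fix s assume s: "s \<in> rhp"
    have "dist (a * f s + b * g s) (a * f' s + b * g' s) \<le>
          cmod a * dist (f s) (f' s) + cmod b * dist (g s) (g' s)"
      unfolding dist_norm norm_mult[symmetric]
      by (rule order_trans[OF _ norm_triangle_ineq]) (simp add: algebra_simps)
    also have "\<dots> \<le> cmod a * (e / m) + cmod b * (e / m)"
      using f'(2)[OF s] g'(2)[OF s] by (intro add_mono mult_left_mono) auto
    also have "\<dots> = (m - 1) * (e / m)" unfolding distrib_right[symmetric] by (simp add: m_def)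
    also have "\<dots> < m * (e / m)" using e by (intro mult_strict_right_mono) auto
    also have "\<dots> = e" using m by simp
    finally show "dist ((\<lambda>s\<in>rhp. a * f s + b * g s) s) ((\<lambda>s\<in>rhp. a * f' s + b * g' s) s) < e"
      using s by simp
  qed
qed simp

lemma AP_plus_mult:
  assumes "f \<in> AP_plus" "g \<in> AP_plus"
  shows "(\<lambda>s\<in>rhp. f s * g s) \<in> AP_plus"
proof (rule AP_plus_uniform_limit)
  fix e :: real assume "e > 0"
  \<comment> \<open>The approximation of \<open>g\<close> is chosen first: the accuracy needed for \<open>f\<close> depends on its bound.\<close>
  obtain M where M: "M > 0" "\<And>s. s \<in> rhp \<Longrightarrow> cmod (f s) \<le> M"
    using AP_plus_bounded[OF assms(1)] by (auto simp: bounded_pos)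
  have "e / (2 * M) > 0" using \<open>e > 0\<close> M by simp
  then obtain g' where g': "g' \<in> exp_span" "\<And>s. s \<in> rhp \<Longrightarrow> dist (g s) (g' s) < e / (2 * M)"
    using AP_plus_approx[OF assms(2)] by blast
  obtain N where N: "N > 0" "\<And>s. s \<in> rhp \<Longrightarrow> cmod (g' s) \<le> N"
    using exp_span_bounded[OF g'(1)] by (auto simp: bounded_pos)
  have "e / (2 * N) > 0" using \<open>e > 0\<close> N by simp
  then obtain f' where f': "f' \<in> exp_span" "\<And>s. s \<in> rhp \<Longrightarrow> dist (f s) (f' s) < e / (2 * N)"
    using AP_plus_approx[OF assms(1)] by blast
  show "\<exists>h\<in>AP_plus. \<forall>s\<in>rhp. dist ((\<lambda>s\<in>rhp. f s * g s) s) (h s) < e"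
  proof (intro bexI ballI)
    show "(\<lambda>s\<in>rhp. f' s * g' s) \<in> AP_plus"
      using exp_span_mult[OF f'(1) g'(1)] exp_span_subset_AP_plus by blast
    fix s assume s: "s \<in> rhp"
    have "dist (f s * g s) (f' s * g' s) \<le>
          cmod (f s) * dist (g s) (g' s) + dist (f s) (f' s) * cmod (g' s)"
      unfolding dist_norm norm_mult[symmetric]
      by (rule order_trans[OF _ norm_triangle_ineq]) (simp add: algebra_simps)
    also have "\<dots> \<le> M * dist (g s) (g' s) + dist (f s) (f' s) * N"
      using M N s by (intro add_mono mult_right_mono mult_left_mono) auto
    also have "\<dots> < M * (e / (2 * M)) + e / (2 * N) * N"
      using M N f'(2)[OF s] g'(2)[OF s]
      by (intro add_strict_mono mult_strict_right_mono mult_strict_left_mono) auto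
    also have "\<dots> = e" using M N by simp
    finally show "dist ((\<lambda>s\<in>rhp. f s * g s) s) ((\<lambda>s\<in>rhp. f' s * g' s) s) < e"
      using s by simp
  qed
qed simp

lemma AP_plus_shift:
  assumes "f \<in> AP_plus" "0 \<le> u"
  shows "(\<lambda>s\<in>rhp. f (s + of_real u)) \<in> AP_plus"
proof (rule AP_plus_uniform_limit)
  fix e :: real assume "e > 0"
  then obtain g where g: "g \<in> exp_span" "\<And>s. s \<in> rhp \<Longrightarrow> dist (f s) (g s) < e"
    using AP_plus_approx[OF assms(1)] by blast
  then show "\<exists>h\<in>AP_plus. \<forall>s\<in>rhp. dist ((\<lambda>s\<in>rhp. f (s + of_real u)) s) (h s) < e"
    using exp_span_shift[OF g(1) assms(2)] exp_span_subset_AP_plus assms(2)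
    by (intro bexI[of _ "\<lambda>s\<in>rhp. g (s + of_real u)"]) auto
qed simp

lemma tame_AP_plus: "f \<in> AP_plus \<Longrightarrow> tame f"
  by (rule tame_uniform_limit) (meson AP_plus_approx tame_exp_span)

lemma AP_plus_holomorphic:
  assumes f: "f \<in> AP_plus"
  shows "f holomorphic_on rhp_open"
proof -
  have "\<exists>g\<in>exp_span. \<forall>s\<in>rhp. dist (f s) (g s) < inverse (real (Suc n))" for n
    using f by (simp add: AP_plus_iff)
  then obtain g where g: "\<And>n. g n \<in> exp_span"
    "\<And>n s. s \<in> rhp \<Longrightarrow> dist (f s) (g n s) < inverse (real (Suc n))"
    by metis
  have lim: "uniform_limit rhp g f sequentially"
  proof (rule uniform_limitI)
    fix e :: real assume "e > 0"
    have "eventually (\<lambda>n. inverse (real (Suc n)) < e) sequentially"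
      using \<open>e > 0\<close> LIMSEQ_inverse_real_of_nat order_tendstoD(2) by blast
    then show "\<forall>\<^sub>F n in sequentially. \<forall>s\<in>rhp. dist (g n s) (f s) < e"
      by eventually_elim (metis g(2) dist_commute less_trans)
  qed
  show ?thesis
  proof (rule holomorphic_uniform_sequence[OF open_rhp_open exp_span_holomorphic[OF g(1)]])
    fix x assume "x \<in> rhp_open"
    then obtain d where "d > 0" "cball x d \<subseteq> rhp_open"
      using open_rhp_open open_contains_cball by blast
    then show "\<exists>d>0. cball x d \<subseteq> rhp_open \<and> uniform_limit (cball x d) g f sequentially"
      using uniform_limit_on_subset[OF lim] rhp_open_subset by blast
  qed
qed

text \<open>
  The partial sums of the Neumann series lie in \<open>AP_plus\<close>, and the \<open>N\<close>-th one is within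
  \<open>q ^ N / (1 - q)\<close> of the inverse.
\<close>
lemma AP_plus_inverse:
  assumes f: "f \<in> AP_plus" and q: "q < 1" "\<And>s. s \<in> rhp \<Longrightarrow> cmod (f s) \<le> q"
  shows "(\<lambda>s\<in>rhp. 1 / (1 - f s)) \<in> AP_plus"
proof (rule AP_plus_uniform_limit)
  have "0 \<le> q" using q(2)[OF of_nat_in_rhp[of 0]] norm_ge_zero order_trans by blast
  have partial: "(\<lambda>s\<in>rhp. \<Sum>n<N. f s ^ n) \<in> AP_plus" for N
  proof (induction N)
    case 0
    show ?case using AP_plus_const[of 0] by (simp add: restrict_def cong: if_cong)
  next
    case (Suc N)
    have "(\<lambda>s\<in>rhp. 1 * (\<lambda>s\<in>rhp. 1) s + 1 * (\<lambda>s\<in>rhp. f s * (\<lambda>s\<in>rhp. \<Sum>n<N. f s ^ n) s) s) \<in> AP_plus"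
      by (intro AP_plus_lincomb AP_plus_const AP_plus_mult f Suc)
    then show ?case
      by (rule back_subst[of "\<lambda>x. x \<in> AP_plus"])
        (auto simp: fun_eq_iff sum.lessThan_Suc_shift sum_distrib_left simp del: sum.lessThan_Suc)
  qed
  fix e :: real assume e: "e > 0"
  have "(\<lambda>N. q ^ N / (1 - q)) \<longlonglongrightarrow> 0 / (1 - q)"
    using \<open>0 \<le> q\<close> q(1) by (intro tendsto_intros LIMSEQ_realpow_zero) auto
  then have "eventually (\<lambda>N. q ^ N / (1 - q) < e) sequentially"
    using e by (simp add: order_tendstoD(2))
  then obtain N where N: "q ^ N / (1 - q) < e"
    by (auto simp: eventually_sequentially)
  have "dist (1 / (1 - f s)) (\<Sum>n<N. f s ^ n) < e" if s: "s \<in> rhp" for s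
  proof -
    have ne: "f s \<noteq> 1" using q(1) q(2)[OF s] by auto
    have low: "1 - q \<le> cmod (1 - f s)"
      using q(2)[OF s] norm_triangle_ineq2[of 1 "f s"] by simp
    have "1 / (1 - f s) - (\<Sum>n<N. f s ^ n) = f s ^ N / (1 - f s)"
      using ne by (simp add: sum_gp_strict divide_simps)
    then have "dist (1 / (1 - f s)) (\<Sum>n<N. f s ^ n) = cmod (f s) ^ N / cmod (1 - f s)"
      by (simp add: dist_norm norm_divide norm_power)
    also have "\<dots> \<le> q ^ N / (1 - q)"
      using q(1) q(2)[OF s] low \<open>0 \<le> q\<close> by (intro frac_le power_mono) auto
    finally show ?thesis using N by simp
  qed
  then show "\<exists>g\<in>AP_plus. \<forall>s\<in>rhp. dist ((\<lambda>s\<in>rhp. 1 / (1 - f s)) s) (g s) < e"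
    using partial by (intro bexI[OF _ partial[of N]]) simp
qed simp

section \<open>Functions vanishing at infinity\<close>

lemma A0_iff:
  "f \<in> A0 \<longleftrightarrow> f \<in> extensional rhp \<and> f holomorphic_on rhp_open \<and> continuous_on rhp f \<and>
     (\<forall>e>0. \<exists>R. \<forall>s\<in>rhp. R \<le> cmod s \<longrightarrow> cmod (f s) < e)"
  by (auto simp: A0_def PiE_def tendsto_iff eventually_inf_principal eventually_at_infinity) blast+

lemma restrict_holomorphic_iff [simp]:
  "(\<lambda>s\<in>rhp. f s) holomorphic_on rhp_open \<longleftrightarrow> f holomorphic_on rhp_open"
  by (rule holomorphic_cong) (use rhp_open_subset in auto)

lemma A0_decay:
  assumes "f \<in> A0" "e > 0"
  obtains R where "\<And>s. s \<in> rhp \<Longrightarrow> R \<le> cmod s \<Longrightarrow> cmod (f s) < e"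
  using assms unfolding A0_iff by blast

lemma A0_bounded:
  assumes f: "f \<in> A0"
  shows "bounded (f ` rhp)"
proof -
  obtain R where R: "\<And>s. s \<in> rhp \<Longrightarrow> R \<le> cmod s \<Longrightarrow> cmod (f s) < 1"
    using A0_decay[OF f zero_less_one] by blast
  have "compact (f ` (rhp \<inter> cball 0 R))"
    using f continuous_on_subset[of rhp f "rhp \<inter> cball 0 R"]
    by (intro compact_continuous_image closed_Int_compact closed_rhp) (auto simp: A0_iff)
  then have "bounded (f ` (rhp \<inter> cball 0 R))" by (rule compact_imp_bounded)
  then obtain M where "\<forall>s\<in>rhp \<inter> cball 0 R. cmod (f s) \<le> M"
    by (auto simp: bounded_iff)
  then have M: "cmod (f s) \<le> M" if "s \<in> rhp" "cmod s \<le> R" for s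
    using that by simp
  have "cmod (f s) \<le> max M 1" if "s \<in> rhp" for s
    using R[OF that] M[OF that] by (cases "R \<le> cmod s") auto
  then show ?thesis by (auto simp: bounded_iff)
qed

text \<open>
  Heine's theorem gives uniform continuity on a large half-disc; outside it all values are small. The
  half-disc has radius \<open>R + 1\<close>, so that two points at distance less than \<open>1\<close> lie both inside it or
  both outside the half-disc of radius \<open>R\<close>.
\<close>
lemma tame_A0:
  assumes f: "f \<in> A0"
  shows "tame f"
  unfolding tame_def uniformly_continuous_on_def
proof (intro conjI allI impI)
  fix e :: real assume e: "e > 0"
  then have "e/2 > 0" by simp
  then obtain R where R: "\<And>s. s \<in> rhp \<Longrightarrow> R \<le> cmod s \<Longrightarrow> cmod (f s) < e/2"
    using A0_decay[OF f] by blast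
  have both: "dist (f s) (f z) < e" if "s \<in> rhp" "z \<in> rhp" "R \<le> cmod s" "R \<le> cmod z" for s z
    using R[OF that(1,3)] R[OF that(2,4)] norm_triangle_ineq4[of "f s" "f z"]
    by (simp add: dist_norm)
  show "\<exists>R. \<forall>s\<in>rhp. \<forall>z\<in>rhp. R \<le> Re s \<longrightarrow> R \<le> Re z \<longrightarrow> dist (f s) (f z) < e"
    using both complex_Re_le_cmod order_trans by (intro exI[of _ R]) blast
  have "continuous_on (rhp \<inter> cball 0 (R + 1)) f"
    using f continuous_on_subset[of rhp f] by (auto simp: A0_iff)
  then have "uniformly_continuous_on (rhp \<inter> cball 0 (R + 1)) f"
    by (intro compact_uniformly_continuous closed_Int_compact closed_rhp) auto
  then obtain d where d: "d > 0"
    "\<And>s z. s \<in> rhp \<Longrightarrow> z \<in> rhp \<Longrightarrow> cmod s \<le> R + 1 \<Longrightarrow> cmod z \<le> R + 1 \<Longrightarrow>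
       dist z s < d \<Longrightarrow> dist (f z) (f s) < e"
    using e unfolding uniformly_continuous_on_def by (auto simp: Ball_def)
  have "dist (f z) (f s) < e" if "s \<in> rhp" "z \<in> rhp" "dist z s < min d 1" for s z
  proof (cases "R \<le> cmod s \<and> R \<le> cmod z")
    case True
    then show ?thesis using both that by blast
  next
    case False
    moreover have "\<bar>cmod z - cmod s\<bar> < 1"
      using that(3) norm_triangle_ineq3[of z s] by (simp add: dist_norm)
    ultimately have "cmod s \<le> R + 1" "cmod z \<le> R + 1" by linarith+
    with that d(2) show ?thesis by simp
  qed
  then show "\<exists>d>0. \<forall>s\<in>rhp. \<forall>z\<in>rhp. dist z s < d \<longrightarrow> dist (f z) (f s) < e"
    using d(1) by (intro exI[of _ "min d 1"]) auto
qed

lemma right_limit_A0: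
  assumes f: "f \<in> A0"
  shows "right_limit f = 0"
proof -
  have "(\<lambda>n. f (of_nat n)) \<longlonglongrightarrow> 0"
  proof (rule LIMSEQ_I)
    fix e :: real assume "e > 0"
    then obtain R where R: "\<And>s. s \<in> rhp \<Longrightarrow> R \<le> cmod s \<Longrightarrow> cmod (f s) < e"
      using A0_decay[OF f] by blast
    obtain N where "R \<le> real N" using real_arch_simple by blast
    then show "\<exists>N. \<forall>n\<ge>N. cmod (f (of_nat n) - 0) < e"
      using R by (intro exI[of _ N]) auto
  qed
  then show ?thesis by (simp add: right_limit_def limI)
qed

lemma A0_zero: "(\<lambda>s\<in>rhp. 0) \<in> A0"
  by (auto simp: A0_iff continuous_on_restrict)

lemma A0_lincomb:
  assumes f: "f \<in> A0" and g: "g \<in> A0"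
  shows "(\<lambda>s\<in>rhp. a * f s + b * g s) \<in> A0"
proof -
  have "\<exists>R. \<forall>s\<in>rhp. R \<le> cmod s \<longrightarrow> cmod (a * f s + b * g s) < e" if "e > 0" for e
  proof -
    define m where "m = cmod a + cmod b + 1"
    have m: "m > 0" by (simp add: m_def add_nonneg_pos)
    with that have e: "e / m > 0" by simp
    obtain R where R: "\<And>s. s \<in> rhp \<Longrightarrow> R \<le> cmod s \<Longrightarrow> cmod (f s) < e / m"
      using A0_decay[OF f e] by blast
    obtain R' where R': "\<And>s. s \<in> rhp \<Longrightarrow> R' \<le> cmod s \<Longrightarrow> cmod (g s) < e / m"
      using A0_decay[OF g e] by blast
    have "cmod (a * f s + b * g s) < e" if s: "s \<in> rhp" "max R R' \<le> cmod s" for s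
    proof -
      have "cmod (a * f s + b * g s) \<le> cmod a * cmod (f s) + cmod b * cmod (g s)"
        by (metis norm_mult norm_triangle_ineq)
      also have "\<dots> \<le> cmod a * (e / m) + cmod b * (e / m)"
        using s R[of s] R'[of s] by (intro add_mono mult_left_mono) auto
      also have "\<dots> = (m - 1) * (e / m)" unfolding distrib_right[symmetric] by (simp add: m_def)
      also have "\<dots> < m * (e / m)" using e by (intro mult_strict_right_mono) auto
      also have "\<dots> = e" using m by simp
      finally show ?thesis .
    qed
    then show ?thesis by blast
  qed
  then show ?thesis
    using f g by (auto simp: A0_iff intro!: holomorphic_intros continuous_intros)
qed

text \<open>
  Besides making \<open>A0\<close> an ideal of the algebra, this puts \<open>a / (1 - a)\<close> into \<open>A0\<close> when \<open>1 - a\<close> is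
  bounded away from zero.
\<close>
lemma A0_mult_bounded:
  assumes f: "f \<in> A0"
    and h: "h holomorphic_on rhp_open" "continuous_on rhp h" "bounded (h ` rhp)"
  shows "(\<lambda>s\<in>rhp. f s * h s) \<in> A0"
proof -
  obtain M where M: "M > 0" "\<And>s. s \<in> rhp \<Longrightarrow> cmod (h s) \<le> M"
    using h(3) by (auto simp: bounded_pos)
  have "\<exists>R. \<forall>s\<in>rhp. R \<le> cmod s \<longrightarrow> cmod (f s * h s) < e" if "e > 0" for e
  proof -
    have e: "e / M > 0" using that M by simp
    obtain R where R: "\<And>s. s \<in> rhp \<Longrightarrow> R \<le> cmod s \<Longrightarrow> cmod (f s) < e / M"
      using A0_decay[OF f e] by blast
    have "cmod (f s * h s) < e" if s: "s \<in> rhp" "R \<le> cmod s" for s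
    proof -
      have "cmod (f s * h s) \<le> cmod (f s) * M"
        using M s by (simp add: norm_mult mult_left_mono)
      also have "\<dots> < e / M * M"
        using R[OF s] M by (intro mult_strict_right_mono) auto
      finally show ?thesis using M by simp
    qed
    then show ?thesis by blast
  qed
  then show ?thesis
    using f h by (auto simp: A0_iff intro!: holomorphic_intros continuous_intros)
qed

lemma A0_shift:
  assumes f: "f \<in> A0" and u: "0 \<le> u"
  shows "(\<lambda>s\<in>rhp. f (s + of_real u)) \<in> A0"
proof -
  have "(f \<circ> (\<lambda>s. s + of_real u)) holomorphic_on rhp_open"
    using f u
    by (intro holomorphic_on_compose_gen[where t = rhp_open] holomorphic_intros)
      (auto simp: A0_iff rhp_open_def)
  moreover have "continuous_on rhp (\<lambda>s. f (s + of_real u))"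
  proof (rule continuous_on_compose2[of rhp f])
    show "continuous_on rhp f" using f by (simp add: A0_iff)
    show "continuous_on rhp (\<lambda>s. s + of_real u)" by (intro continuous_intros)
  qed (use u in auto)
  moreover have "\<exists>R. \<forall>s\<in>rhp. R \<le> cmod s \<longrightarrow> cmod (f (s + of_real u)) < e" if e: "e > 0" for e
  proof -
    obtain R where R: "\<And>s. s \<in> rhp \<Longrightarrow> R \<le> cmod s \<Longrightarrow> cmod (f s) < e"
      using A0_decay[OF f e] by blast
    have "cmod (f (s + of_real u)) < e" if "s \<in> rhp" "R + u \<le> cmod s" for s
      using that u R[of "s + of_real u"] norm_diff_ineq[of s "of_real u"] by simp
    then show ?thesis by blast
  qed
  ultimately show ?thesis by (auto simp: A0_iff o_def)
qed

section \<open>The algebra\<close>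

lemma algebraI:
  assumes "a \<in> A0" "b \<in> AP_plus"
  shows "(\<lambda>s\<in>rhp. a s + b s) \<in> A0_AP_plus"
  using assms by (auto simp: A0_AP_plus_def)

lemma algebraE:
  assumes "f \<in> A0_AP_plus"
  obtains a b where "a \<in> A0" "b \<in> AP_plus" "f = (\<lambda>s\<in>rhp. a s + b s)"
  using assms by (auto simp: A0_AP_plus_def)

lemma A0_subset_algebra: "A0 \<subseteq> A0_AP_plus"
proof
  fix f assume "f \<in> A0"
  with algebraI[OF this AP_plus_const[of 0]] show "f \<in> A0_AP_plus"
    by (auto elim!: back_subst[of "\<lambda>x. x \<in> A0_AP_plus"]
        simp: fun_eq_iff A0_iff extensional_def)
qed

lemma AP_plus_subset_algebra: "AP_plus \<subseteq> A0_AP_plus"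
proof
  fix f assume "f \<in> AP_plus"
  with algebraI[OF A0_zero this] show "f \<in> A0_AP_plus"
    by (auto elim!: back_subst[of "\<lambda>x. x \<in> A0_AP_plus"]
        simp: fun_eq_iff AP_plus_iff extensional_def)
qed

lemma algebra_extensional: "f \<in> A0_AP_plus \<Longrightarrow> f \<in> extensional rhp"
  by (auto elim: algebraE)

lemma algebra_const: "(\<lambda>s\<in>rhp. c) \<in> A0_AP_plus"
  using AP_plus_const AP_plus_subset_algebra by blast

lemma tame_algebra: "f \<in> A0_AP_plus \<Longrightarrow> tame f"
proof (elim algebraE)
  fix a b assume "a \<in> A0" "b \<in> AP_plus" "f = (\<lambda>s\<in>rhp. a s + b s)"
  then show "tame f"
    using tame_cong[OF tame_add[OF tame_A0 tame_AP_plus], of a b f] by simp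
qed

lemma tame_continuous: "tame f \<Longrightarrow> continuous_on rhp f"
  by (simp add: tame_def uniformly_continuous_imp_continuous)

lemma algebra_lincomb:
  assumes "f \<in> A0_AP_plus" "g \<in> A0_AP_plus"
  shows "(\<lambda>s\<in>rhp. c * f s + d * g s) \<in> A0_AP_plus"
proof -
  obtain a b where f: "a \<in> A0" "b \<in> AP_plus" "f = (\<lambda>s\<in>rhp. a s + b s)"
    using assms(1) by (rule algebraE)
  obtain a' b' where g: "a' \<in> A0" "b' \<in> AP_plus" "g = (\<lambda>s\<in>rhp. a' s + b' s)"
    using assms(2) by (rule algebraE)
  from algebraI[OF A0_lincomb[OF f(1) g(1), of c d] AP_plus_lincomb[OF f(2) g(2), of c d]]
  show ?thesis
    by (auto elim!: back_subst[of "\<lambda>x. x \<in> A0_AP_plus"] simp: fun_eq_iff f g algebra_simps)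
qed

lemma algebra_add:
  assumes "f \<in> A0_AP_plus" "g \<in> A0_AP_plus"
  shows "(\<lambda>s\<in>rhp. f s + g s) \<in> A0_AP_plus"
  using algebra_lincomb[OF assms, of 1 1] by simp

lemma algebra_scale:
  assumes "f \<in> A0_AP_plus"
  shows "(\<lambda>s\<in>rhp. c * f s) \<in> A0_AP_plus"
  using algebra_lincomb[OF assms assms, of c 0] by simp

text \<open>
  In \<open>(a + b) (a' + b')\<close> every term except \<open>b b'\<close> has a factor in \<open>A0\<close> and a bounded cofactor.
\<close>
lemma algebra_mult:
  assumes "f \<in> A0_AP_plus" "g \<in> A0_AP_plus"
  shows "(\<lambda>s\<in>rhp. f s * g s) \<in> A0_AP_plus"
proof -
  obtain a b where f: "a \<in> A0" "b \<in> AP_plus" "f = (\<lambda>s\<in>rhp. a s + b s)"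
    using assms(1) by (rule algebraE)
  obtain a' b' where g: "a' \<in> A0" "b' \<in> AP_plus" "g = (\<lambda>s\<in>rhp. a' s + b' s)"
    using assms(2) by (rule algebraE)
  have aa: "(\<lambda>s\<in>rhp. a s * a' s) \<in> A0"
    using g(1) by (intro A0_mult_bounded f A0_bounded) (auto simp: A0_iff)
  have ab: "(\<lambda>s\<in>rhp. a s * b' s) \<in> A0"
    by (intro A0_mult_bounded f g AP_plus_bounded AP_plus_holomorphic
        tame_continuous tame_AP_plus)
  have ba: "(\<lambda>s\<in>rhp. a' s * b s) \<in> A0"
    by (intro A0_mult_bounded f g AP_plus_bounded AP_plus_holomorphic
        tame_continuous tame_AP_plus)
  from algebraI[OF A0_lincomb[OF A0_lincomb[OF aa ab, of 1 1] ba, of 1 1] AP_plus_mult[OF f(2) g(2)]]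
  show ?thesis
    by (auto elim!: back_subst[of "\<lambda>x. x \<in> A0_AP_plus"] simp: fun_eq_iff f g algebra_simps)
qed

lemma translate_A0:
  assumes f: "f \<in> A0" and v: "v \<in> {0..1}"
  shows "translate v f \<in> A0"
proof (cases "v < 1")
  case True
  then have "0 \<le> v / (1 - v)" using v by simp
  from A0_shift[OF f this] show ?thesis unfolding translate_less_1[OF True] .
next
  case False
  with v have "v = 1" by simp
  then show ?thesis using A0_zero by (simp only: translate_1 right_limit_A0[OF f])
qed

lemma translate_AP_plus:
  assumes f: "f \<in> AP_plus" and v: "v \<in> {0..1}"
  shows "translate v f \<in> AP_plus"
proof (cases "v < 1")
  case True
  then have "0 \<le> v / (1 - v)" using v by simp
  from AP_plus_shift[OF f this] show ?thesis unfolding translate_less_1[OF True] .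
next
  case False
  with v have "v = 1" by simp
  then show ?thesis using AP_plus_const by (simp only: translate_1)
qed

lemma translate_add:
  assumes "tame f" "tame g" "v \<in> {0..1}"
  shows "translate v (\<lambda>s\<in>rhp. f s + g s) = (\<lambda>s\<in>rhp. translate v f s + translate v g s)"
  using assms by (intro translate_lift2) (auto intro!: continuous_intros)

lemma translate_mult:
  assumes "tame f" "tame g" "v \<in> {0..1}"
  shows "translate v (\<lambda>s\<in>rhp. f s * g s) = (\<lambda>s\<in>rhp. translate v f s * translate v g s)"
  using assms by (intro translate_lift2) (auto intro!: continuous_intros)

lemma translate_scale:
  assumes "tame f" "v \<in> {0..1}"
  shows "translate v (\<lambda>s\<in>rhp. c * f s) = (\<lambda>s\<in>rhp. c * translate v f s)"
  using assms
  by (intro translate_lift2[where F = "\<lambda>x y. c * x" and g = f]) (auto intro!: continuous_intros)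

lemma translate_algebra:
  assumes "f \<in> A0_AP_plus" "v \<in> {0..1}"
  shows "translate v f \<in> A0_AP_plus"
proof -
  obtain a b where f: "a \<in> A0" "b \<in> AP_plus" "f = (\<lambda>s\<in>rhp. a s + b s)"
    using assms(1) by (rule algebraE)
  then show ?thesis
    using assms(2) by (auto simp: translate_add tame_A0 tame_AP_plus
        intro!: algebraI translate_A0 translate_AP_plus)
qed

section \<open>Characters are contractive on each summand\<close>

abbreviation "algebra_characters \<equiv> characters A0_AP_plus"

lemma character_add:
  "\<phi> \<in> algebra_characters \<Longrightarrow> f \<in> A0_AP_plus \<Longrightarrow> g \<in> A0_AP_plus \<Longrightarrow>
   \<phi> (\<lambda>s\<in>rhp. f s + g s) = \<phi> f + \<phi> g"
  by (simp add: characters_def)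

lemma character_mult:
  "\<phi> \<in> algebra_characters \<Longrightarrow> f \<in> A0_AP_plus \<Longrightarrow> g \<in> A0_AP_plus \<Longrightarrow>
   \<phi> (\<lambda>s\<in>rhp. f s * g s) = \<phi> f * \<phi> g"
  by (simp add: characters_def)

lemma character_scale:
  "\<phi> \<in> algebra_characters \<Longrightarrow> f \<in> A0_AP_plus \<Longrightarrow> \<phi> (\<lambda>s\<in>rhp. c * f s) = c * \<phi> f"
  by (simp add: characters_def)

lemma character_one:
  assumes "\<phi> \<in> algebra_characters"
  shows "\<phi> (\<lambda>s\<in>rhp. 1) = 1"
proof -
  obtain f where f: "f \<in> A0_AP_plus" "\<phi> f \<noteq> 0"
    using assms by (auto simp: characters_def)
  have "(\<lambda>s\<in>rhp. (\<lambda>s\<in>rhp. 1) s * f s) = f"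
    using algebra_extensional[OF f(1)] by (auto simp: extensional_def)
  with character_mult[OF assms algebra_const f(1), of 1] f(2) show ?thesis by simp
qed

lemma character_const:
  assumes "\<phi> \<in> algebra_characters"
  shows "\<phi> (\<lambda>s\<in>rhp. c) = c"
  using character_scale[OF assms algebra_const[of 1], of c] character_one[OF assms]
  by (simp add: restrict_def cong: if_cong)

lemma characterI:
  assumes "\<phi> \<in> extensional A0_AP_plus"
    and "\<And>f g. f \<in> A0_AP_plus \<Longrightarrow> g \<in> A0_AP_plus \<Longrightarrow> \<phi> (\<lambda>s\<in>rhp. f s + g s) = \<phi> f + \<phi> g"
    and "\<And>c f. f \<in> A0_AP_plus \<Longrightarrow> \<phi> (\<lambda>s\<in>rhp. c * f s) = c * \<phi> f"
    and "\<And>f g. f \<in> A0_AP_plus \<Longrightarrow> g \<in> A0_AP_plus \<Longrightarrow> \<phi> (\<lambda>s\<in>rhp. f s * g s) = \<phi> f * \<phi> g"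
    and "\<phi> (\<lambda>s\<in>rhp. 1) = 1"
  shows "\<phi> \<in> algebra_characters"
  using assms(1-4) assms(5) algebra_const[of 1]
  by (auto simp: characters_def PiE_def intro!: bexI[of _ "\<lambda>s\<in>rhp. 1"])

text \<open>
  If \<open>\<bar>\<phi> f\<bar>\<close> exceeded the bound \<open>r\<close>, then \<open>g = f / \<phi> f\<close> would satisfy \<open>\<phi> g = 1\<close> and
  \<open>\<bar>g\<bar> \<le> q < 1\<close>. Applying \<open>\<phi>\<close> to \<open>k = 1 + g k\<close>, where \<open>k\<close> is the inverse of \<open>1 - g\<close>, would give
  \<open>\<phi> k = 1 + \<phi> k\<close>. The set \<open>B\<close> stands for one of the two summands, where the inverse can be
  exhibited.
\<close>
lemma character_bound:
  assumes \<phi>: "\<phi> \<in> algebra_characters" and B: "B \<subseteq> A0_AP_plus"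
    and scale: "\<And>c g. g \<in> B \<Longrightarrow> (\<lambda>s\<in>rhp. c * g s) \<in> B"
    and inv: "\<And>g q. g \<in> B \<Longrightarrow> q < 1 \<Longrightarrow> (\<And>s. s \<in> rhp \<Longrightarrow> cmod (g s) \<le> q) \<Longrightarrow>
                (\<lambda>s\<in>rhp. 1 / (1 - g s)) \<in> A0_AP_plus"
    and f: "f \<in> B" "\<And>s. s \<in> rhp \<Longrightarrow> cmod (f s) \<le> r"
  shows "cmod (\<phi> f) \<le> r"
proof (rule ccontr)
  assume less: "\<not> cmod (\<phi> f) \<le> r"
  have "0 \<le> r" using f(2)[OF of_nat_in_rhp[of 0]] norm_ge_zero order_trans by blast
  with less have pos: "cmod (\<phi> f) > 0" by linarith
  define q where "q = r / cmod (\<phi> f)"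
  have q: "q < 1" using less pos by (simp add: q_def)
  define g where "g = (\<lambda>s\<in>rhp. (1 / \<phi> f) * f s)"
  have g: "g \<in> B" unfolding g_def by (rule scale[OF f(1)])
  have gq: "cmod (g s) \<le> q" if "s \<in> rhp" for s
    using that f(2) pos by (simp add: g_def q_def norm_divide divide_right_mono)
  have \<phi>g: "\<phi> g = 1"
    using pos character_scale[OF \<phi>, of f "1 / \<phi> f"] f(1) B by (auto simp: g_def)
  define k where "k = (\<lambda>s\<in>rhp. 1 / (1 - g s))"
  have k: "k \<in> A0_AP_plus" unfolding k_def using inv[OF g q gq] by simp
  have gk: "(\<lambda>s\<in>rhp. g s * k s) \<in> A0_AP_plus"
    using g B k by (intro algebra_mult) auto
  have "k = (\<lambda>s\<in>rhp. (\<lambda>s\<in>rhp. 1) s + (\<lambda>s\<in>rhp. g s * k s) s)"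
  proof
    fix s
    have "g s \<noteq> 1" if "s \<in> rhp" using gq[OF that] q by auto
    then show "k s = (\<lambda>s\<in>rhp. (\<lambda>s\<in>rhp. 1) s + (\<lambda>s\<in>rhp. g s * k s) s) s"
      by (auto simp: k_def divide_simps)
  qed
  then have "\<phi> k = \<phi> (\<lambda>s\<in>rhp. (\<lambda>s\<in>rhp. 1) s + (\<lambda>s\<in>rhp. g s * k s) s)" by simp
  also have "\<dots> = 1 + \<phi> g * \<phi> k"
    using g B k by (subst character_add[OF \<phi> algebra_const gk])
      (auto simp: character_one[OF \<phi>] character_mult[OF \<phi>])
  finally show False using \<phi>g by simp
qed

lemma character_bound_A0:
  assumes "\<phi> \<in> algebra_characters" "f \<in> A0" "\<And>s. s \<in> rhp \<Longrightarrow> cmod (f s) \<le> r"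
  shows "cmod (\<phi> f) \<le> r"
proof (rule character_bound[OF assms(1) A0_subset_algebra _ _ assms(2,3)])
  show "(\<lambda>s\<in>rhp. c * g s) \<in> A0" if "g \<in> A0" for c g
    using A0_lincomb[OF that that, of c 0] by simp
  show "(\<lambda>s\<in>rhp. 1 / (1 - g s)) \<in> A0_AP_plus"
    if g: "g \<in> A0" and q: "q < 1" "\<And>s. s \<in> rhp \<Longrightarrow> cmod (g s) \<le> q" for g q
  proof -
    have ne: "g s \<noteq> 1" if "s \<in> rhp" for s using q(1) q(2)[OF that] by auto
    have "cmod (1 / (1 - g s)) \<le> 1 / (1 - q)" if "s \<in> rhp" for s
      using q(1) q(2)[OF that] norm_triangle_ineq2[of 1 "g s"]
      by (simp add: norm_divide frac_le)
    then have "bounded ((\<lambda>s. 1 / (1 - g s)) ` rhp)"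
      by (auto simp: bounded_iff)
    then have "(\<lambda>s\<in>rhp. g s * (1 / (1 - g s))) \<in> A0"
      using g ne rhp_open_subset
      by (intro A0_mult_bounded) (auto simp: A0_iff intro!: holomorphic_intros continuous_intros)
    from algebraI[OF this AP_plus_const[of 1]] show ?thesis
      using ne by (auto elim!: back_subst[of "\<lambda>x. x \<in> A0_AP_plus"] simp: fun_eq_iff divide_simps)
  qed
qed

lemma character_bound_AP_plus:
  assumes "\<phi> \<in> algebra_characters" "f \<in> AP_plus" "\<And>s. s \<in> rhp \<Longrightarrow> cmod (f s) \<le> r"
  shows "cmod (\<phi> f) \<le> r"
proof (rule character_bound[OF assms(1) AP_plus_subset_algebra _ _ assms(2,3)])
  show "(\<lambda>s\<in>rhp. c * g s) \<in> AP_plus" if "g \<in> AP_plus" for c g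
    using AP_plus_lincomb[OF that that, of c 0] by simp
  show "(\<lambda>s\<in>rhp. 1 / (1 - g s)) \<in> A0_AP_plus"
    if "g \<in> AP_plus" "q < 1" "\<And>s. s \<in> rhp \<Longrightarrow> cmod (g s) \<le> q" for g q
    using AP_plus_inverse[OF that] AP_plus_subset_algebra by blast
qed

section \<open>The contraction\<close>

text \<open>
  The modulus \<open>d\<close> does not depend on the character, because the bound on characters is uniform. The set
  \<open>B\<close> is again one of the two summands.
\<close>
lemma character_translate_equicontinuous_on_part:
  assumes B: "B \<subseteq> A0_AP_plus"
    and lincomb: "\<And>f g a b. f \<in> B \<Longrightarrow> g \<in> B \<Longrightarrow> (\<lambda>s\<in>rhp. a * f s + b * g s) \<in> B"
    and bound: "\<And>\<phi> f r. \<phi> \<in> algebra_characters \<Longrightarrow> f \<in> B \<Longrightarrow>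
                  (\<And>s. s \<in> rhp \<Longrightarrow> cmod (f s) \<le> r) \<Longrightarrow> cmod (\<phi> f) \<le> r"
    and trans: "\<And>f v. f \<in> B \<Longrightarrow> v \<in> {0..1} \<Longrightarrow> translate v f \<in> B"
    and f: "f \<in> B" and v0: "v0 \<in> {0..1}" and e: "e > 0"
  shows "\<exists>d>0. \<forall>v\<in>{0..1}. dist v v0 < d \<longrightarrow>
           (\<forall>\<phi>\<in>algebra_characters. dist (\<phi> (translate v f)) (\<phi> (translate v0 f)) \<le> e)"
proof -
  have "tame f" using f B tame_algebra by blast
  then obtain d where d: "d > 0"
    "\<And>v s. v \<in> {0..1} \<Longrightarrow> dist v v0 < d \<Longrightarrow> s \<in> rhp \<Longrightarrow>
       dist (translate v f s) (translate v0 f s) < e"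
    using translate_continuous[OF _ v0 e] by blast
  have "dist (\<phi> (translate v f)) (\<phi> (translate v0 f)) \<le> e"
    if v: "v \<in> {0..1}" "dist v v0 < d" and \<phi>: "\<phi> \<in> algebra_characters" for v \<phi>
  proof -
    define g where "g = (\<lambda>s\<in>rhp. 1 * translate v f s + (- 1) * translate v0 f s)"
    have g: "g \<in> B" unfolding g_def by (intro lincomb trans f v v0)
    have "translate v f = (\<lambda>s\<in>rhp. g s + translate v0 f s)"
      by (auto simp: g_def translate_def)
    then have "\<phi> (translate v f) = \<phi> g + \<phi> (translate v0 f)"
      using character_add[OF \<phi>, of g "translate v0 f"] g trans[OF f v0] B by auto
    moreover have "cmod (\<phi> g) \<le> e"
      using d(2)[OF v] by (intro bound[OF \<phi> g]) (auto simp: g_def dist_norm intro: less_imp_le)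
    ultimately show ?thesis by (simp add: dist_norm)
  qed
  with d(1) show ?thesis by blast
qed

lemma character_translate_equicontinuous:
  assumes f: "f \<in> A0_AP_plus" and v0: "v0 \<in> {0..1}" and e: "e > 0"
  shows "\<exists>d>0. \<forall>v\<in>{0..1}. dist v v0 < d \<longrightarrow>
           (\<forall>\<phi>\<in>algebra_characters. dist (\<phi> (translate v f)) (\<phi> (translate v0 f)) \<le> e)"
proof -
  obtain a b where a: "a \<in> A0" and b: "b \<in> AP_plus" and feq: "f = (\<lambda>s\<in>rhp. a s + b s)"
    using f by (rule algebraE)
  from e have e2: "e/2 > 0" by simp
  have "\<exists>d>0. \<forall>v\<in>{0..1}. dist v v0 < d \<longrightarrow>
          (\<forall>\<phi>\<in>algebra_characters. dist (\<phi> (translate v a)) (\<phi> (translate v0 a)) \<le> e/2)"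
    by (rule character_translate_equicontinuous_on_part[where B = A0])
      (fact A0_subset_algebra A0_lincomb character_bound_A0 translate_A0 a v0 e2)+
  then obtain d1 where d1: "d1 > 0"
    "\<And>v \<phi>. v \<in> {0..1} \<Longrightarrow> dist v v0 < d1 \<Longrightarrow> \<phi> \<in> algebra_characters \<Longrightarrow>
       dist (\<phi> (translate v a)) (\<phi> (translate v0 a)) \<le> e/2"
    by blast
  have "\<exists>d>0. \<forall>v\<in>{0..1}. dist v v0 < d \<longrightarrow>
          (\<forall>\<phi>\<in>algebra_characters. dist (\<phi> (translate v b)) (\<phi> (translate v0 b)) \<le> e/2)"
    by (rule character_translate_equicontinuous_on_part[where B = AP_plus])
      (fact AP_plus_subset_algebra AP_plus_lincomb character_bound_AP_plus translate_AP_plus b v0 e2)+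
  then obtain d2 where d2: "d2 > 0"
    "\<And>v \<phi>. v \<in> {0..1} \<Longrightarrow> dist v v0 < d2 \<Longrightarrow> \<phi> \<in> algebra_characters \<Longrightarrow>
       dist (\<phi> (translate v b)) (\<phi> (translate v0 b)) \<le> e/2"
    by blast
  have split: "\<phi> (translate v f) = \<phi> (translate v a) + \<phi> (translate v b)"
    if "\<phi> \<in> algebra_characters" "v \<in> {0..1}" for v \<phi>
    unfolding feq translate_add[OF tame_A0[OF a] tame_AP_plus[OF b] that(2)]
    using translate_A0[OF a that(2)] translate_AP_plus[OF b that(2)]
      A0_subset_algebra AP_plus_subset_algebra
    by (intro character_add[OF that(1)]) auto
  have "dist (\<phi> (translate v f)) (\<phi> (translate v0 f)) \<le> e"
    if "v \<in> {0..1}" "dist v v0 < min d1 d2" "\<phi> \<in> algebra_characters" for v \<phi>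
  proof -
    have "dist (\<phi> (translate v a)) (\<phi> (translate v0 a)) \<le> e/2"
      "dist (\<phi> (translate v b)) (\<phi> (translate v0 b)) \<le> e/2"
      using that d1(2) d2(2) by auto
    then show ?thesis
      unfolding split[OF that(3,1)] split[OF that(3) v0]
      using dist_triangle_add[of "\<phi> (translate v a)" "\<phi> (translate v b)"
          "\<phi> (translate v0 a)" "\<phi> (translate v0 b)"] by linarith
  qed
  with d1(1) d2(1) show ?thesis by (intro exI[of _ "min d1 d2"]) simp
qed

lemma pullback_character:
  assumes \<phi>: "\<phi> \<in> algebra_characters" and v: "v \<in> {0..1}"
  shows "(\<lambda>f\<in>A0_AP_plus. \<phi> (translate v f)) \<in> algebra_characters"
  using v
  by (intro characterI)
    (simp_all add: translate_algebra algebra_const algebra_add algebra_scale algebra_mult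
      translate_add translate_mult translate_scale translate_const tame_algebra
      character_add[OF \<phi>] character_mult[OF \<phi>] character_scale[OF \<phi>] character_one[OF \<phi>])

lemma evaluation_character:
  assumes "z \<in> rhp"
  shows "(\<lambda>f\<in>A0_AP_plus. f z) \<in> algebra_characters"
  using assms by (intro characterI) (auto simp: algebra_add algebra_scale algebra_mult algebra_const)

lemma continuous_map_evaluation:
  "f \<in> A \<Longrightarrow> continuous_map (maximal_ideal_space A) euclidean (\<lambda>\<phi>. \<phi> f)"
  unfolding maximal_ideal_space_def
  by (intro continuous_map_from_subtopology continuous_map_product_projection)

text \<open>
  Moving from \<open>\<phi>0 (T v0 f)\<close> to \<open>\<phi> (T v f)\<close> is done in two steps: changing the character at the fixed
  element \<open>T v0 f\<close> is a basic neighbourhood of the weak-* topology, and changing \<open>v0\<close> to \<open>v\<close> is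
  controlled uniformly in \<open>\<phi>\<close>.
\<close>
lemma continuous_map_pullback_evaluation:
  assumes f: "f \<in> A0_AP_plus"
  shows "continuous_map (prod_topology (top_of_set {0..1}) (maximal_ideal_space A0_AP_plus))
           euclidean (\<lambda>p. snd p (translate (fst p) f))"
  unfolding continuous_map_eq_topcontinuous_at topcontinuous_at_def
proof (intro ballI conjI allI impI)
  let ?I = "top_of_set {0..1::real}" and ?X = "maximal_ideal_space A0_AP_plus"
  let ?F = "\<lambda>p. snd p (translate (fst p) f)"
  fix p V assume p: "p \<in> topspace (prod_topology ?I ?X)"
    and V: "openin euclidean V \<and> ?F p \<in> V"
  obtain v0 \<phi>0 where p_eq: "p = (v0, \<phi>0)" by (cases p)
  with p have v0: "v0 \<in> {0..1}" and \<phi>0: "\<phi>0 \<in> algebra_characters" by auto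
  obtain e where e: "e > 0" "ball (\<phi>0 (translate v0 f)) e \<subseteq> V"
    using V by (auto simp: p_eq open_contains_ball)
  then have e3: "e/3 > 0" by simp
  obtain d where d: "d > 0"
    "\<And>v \<phi>. v \<in> {0..1} \<Longrightarrow> dist v v0 < d \<Longrightarrow> \<phi> \<in> algebra_characters \<Longrightarrow>
       dist (\<phi> (translate v f)) (\<phi> (translate v0 f)) \<le> e/3"
    using character_translate_equicontinuous[OF f v0 e3] by blast
  define U1 where "U1 = {0..1} \<inter> ball v0 d"
  define U2 where "U2 = {\<phi> \<in> topspace ?X. \<phi> (translate v0 f) \<in> ball (\<phi>0 (translate v0 f)) (e/3)}"
  have "openin ?I U1"
    unfolding U1_def by (intro openin_open_Int open_ball)
  moreover have "openin ?X U2"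
    unfolding U2_def
    by (rule openin_continuous_map_preimage[OF
          continuous_map_evaluation[OF translate_algebra[OF f v0]]]) simp
  ultimately have "openin (prod_topology ?I ?X) (U1 \<times> U2)"
    by (simp add: openin_prod_Times_iff)
  moreover have "p \<in> U1 \<times> U2"
    using v0 \<phi>0 d(1) e3 by (simp add: p_eq U1_def U2_def)
  moreover have "?F y \<in> V" if "y \<in> U1 \<times> U2" for y
  proof -
    obtain v \<phi> where y: "y = (v, \<phi>)" by (cases y)
    with that have "dist (\<phi> (translate v f)) (\<phi> (translate v0 f)) \<le> e/3"
      "dist (\<phi>0 (translate v0 f)) (\<phi> (translate v0 f)) < e/3"
      using d(2)[of v \<phi>] by (auto simp: U1_def U2_def dist_commute)
    then have "dist (\<phi>0 (translate v0 f)) (\<phi> (translate v f)) < e"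
      using dist_triangle[of "\<phi>0 (translate v0 f)" "\<phi> (translate v f)" "\<phi> (translate v0 f)"] e(1)
      by (simp add: dist_commute)
    with e(2) show ?thesis by (auto simp: y)
  qed
  ultimately show "\<exists>U. openin (prod_topology ?I ?X) U \<and> p \<in> U \<and> (\<forall>y\<in>U. ?F y \<in> V)"
    by blast
qed auto

theorem theorem1p3:
  shows "topspace (maximal_ideal_space A0_AP_plus) \<noteq> {} \<and>
         contractible_space (maximal_ideal_space A0_AP_plus)"
proof
  let ?X = "maximal_ideal_space A0_AP_plus"
  show "topspace ?X \<noteq> {}"
    using evaluation_character[OF of_nat_in_rhp[of 0]] by auto
  define h where "h p = (\<lambda>f\<in>A0_AP_plus. snd p (translate (fst p) f))"
    for p :: "real \<times> ((complex \<Rightarrow> complex) \<Rightarrow> complex)"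
  have "continuous_map (prod_topology (top_of_set {0..1}) ?X)
          (product_topology (\<lambda>_. euclidean) A0_AP_plus) h"
    unfolding continuous_map_componentwise
    using continuous_map_pullback_evaluation by (auto simp: h_def)
  then have cont: "continuous_map (prod_topology (top_of_set {0..1}) ?X) ?X h"
    unfolding maximal_ideal_space_def[of A0_AP_plus] continuous_map_in_subtopology
    by (auto simp: h_def pullback_character maximal_ideal_space_def[symmetric])
  have start: "h (0, \<phi>) = \<phi>" if "\<phi> \<in> algebra_characters" for \<phi>
  proof -
    have "h (0, \<phi>) = restrict \<phi> A0_AP_plus"
      by (auto simp: h_def fun_eq_iff translate_0 algebra_extensional)
    with that show ?thesis
      by (simp add: characters_def PiE_def extensional_restrict)
  qed
  have final: "h (1, \<phi>) = (\<lambda>f\<in>A0_AP_plus. right_limit f)" if "\<phi> \<in> algebra_characters" for \<phi>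
    using that by (auto simp: h_def translate_1 character_const)
  have "homotopic_with (\<lambda>x. True) ?X ?X id (\<lambda>x. \<lambda>f\<in>A0_AP_plus. right_limit f)"
    by (subst homotopic_with) (use cont start final in auto)
  then show "contractible_space ?X"
    unfolding contractible_space_def by blast
qed

end
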